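(* Any separable metric space of Assouad–Nagata dimension $0$ (i.e. with $\dim_{AN}(X)\le 0$) admits a bi-Lipschitz embedding into the space $(L_\omega,\mu)$.
   Context: For $S>0$, an $S$-chain in a metric space $X$ is a finite sequence $x_1,\dots,x_k$ with $d(x_i,x_{i+1})\le S$ for all $i<k$. A subset is $S$-connected if any two of its points can be joined by an $S$-chain inside the subset; $S$-components of $X$ are maximal $S$-connected subsets. A subset is $D$-bounded if any two of its points are at distance $\le D$. $\dim_{AN}(X)\le 0$ means there is a constant $m\ge1$ such that for every $S>0$ all $S$-components of $X$ are $mS$-bounded. A bi-Lipschitz embedding is an injective map $f$ such that, for some $\lambda>0$, both $f$ and $f^{-1}$ (defined on the image of $f$) are $\lambda$-Lipschitz, i.e. increase distances at most by the factor $\lambda$. The space $(L_\omega,\mu)$: fix a countably infinite set $S$ with a distinguished element $s_0\in S$. $L_\omega$ is the set of all sequences $\bar x=\{x_n\}_{n\in\mathbb{Z}}$ with $x_n\in S$ for which there is $k\in\mathbb{Z}$ with $x_n=s_0$ for all $n<k$. For $\bar x\neq\bar y$, $\mu(\bar x,\bar y)=3^{-m}$ where $m\in\mathbb{Z}$ is the minimal index with $x_m\ne y_m$ (and $\mu(\bar x,\bar x)=0$). *)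

theory Defs
  imports "HOL-Analysis.Analysis"
begin

text \<open>A metric on a carrier set is given as in the locale \<^locale>\<open>Metric_space\<close>. The definitions
  below take the distance function, and where needed the carrier, as explicit arguments.\<close>

definition scale_chain :: "('a \<Rightarrow> 'a \<Rightarrow> real) \<Rightarrow> real \<Rightarrow> 'a list \<Rightarrow> bool"
  where "scale_chain d s xs \<longleftrightarrow> (\<forall>i. Suc i < length xs \<longrightarrow> d (xs ! i) (xs ! Suc i) \<le> s)"

definition scale_connected :: "('a \<Rightarrow> 'a \<Rightarrow> real) \<Rightarrow> real \<Rightarrow> 'a set \<Rightarrow> bool"
  where "scale_connected d s A \<longleftrightarrow>
    (\<forall>x\<in>A. \<forall>y\<in>A. \<exists>xs. xs \<noteq> [] \<and> hd xs = x \<and> last xs = y \<and> set xs \<subseteq> A \<and> scale_chain d s xs)"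

definition scale_component :: "'a set \<Rightarrow> ('a \<Rightarrow> 'a \<Rightarrow> real) \<Rightarrow> real \<Rightarrow> 'a set \<Rightarrow> bool"
  where "scale_component M d s A \<longleftrightarrow> A \<subseteq> M \<and> scale_connected d s A \<and>
    (\<forall>B. A \<subseteq> B \<and> B \<subseteq> M \<and> scale_connected d s B \<longrightarrow> B = A)"

definition dist_bounded :: "('a \<Rightarrow> 'a \<Rightarrow> real) \<Rightarrow> real \<Rightarrow> 'a set \<Rightarrow> bool"
  where "dist_bounded d D A \<longleftrightarrow> (\<forall>x\<in>A. \<forall>y\<in>A. d x y \<le> D)"

definition dim_AN_le_0 :: "'a set \<Rightarrow> ('a \<Rightarrow> 'a \<Rightarrow> real) \<Rightarrow> bool"
  where "dim_AN_le_0 M d \<longleftrightarrow>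
    (\<exists>m\<ge>1. \<forall>s>0. \<forall>A. scale_component M d s A \<longrightarrow> dist_bounded d (m * s) A)"

definition Lipschitz_with :: "real \<Rightarrow> 'a set \<Rightarrow> ('a \<Rightarrow> 'a \<Rightarrow> real) \<Rightarrow> ('b \<Rightarrow> 'b \<Rightarrow> real) \<Rightarrow> ('a \<Rightarrow> 'b) \<Rightarrow> bool"
  where "Lipschitz_with c M d d' f \<longleftrightarrow> (\<forall>x\<in>M. \<forall>y\<in>M. d' (f x) (f y) \<le> c * d x y)"

definition bilipschitz_embedding ::
    "'a set \<Rightarrow> ('a \<Rightarrow> 'a \<Rightarrow> real) \<Rightarrow> 'b set \<Rightarrow> ('b \<Rightarrow> 'b \<Rightarrow> real) \<Rightarrow> ('a \<Rightarrow> 'b) \<Rightarrow> bool"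
  where "bilipschitz_embedding M d M' d' f \<longleftrightarrow> f \<in> M \<rightarrow> M' \<and> inj_on f M \<and>
    (\<exists>c>0. Lipschitz_with c M d d' f \<and> Lipschitz_with c (f ` M) d' d (inv_into M f))"

definition L_omega :: "'s set \<Rightarrow> 's \<Rightarrow> (int \<Rightarrow> 's) set"
  where "L_omega S s0 = {x. range x \<subseteq> S \<and> (\<exists>k. \<forall>n<k. x n = s0)}"

text \<open>The minimum of a set of integers exists only if the set is nonempty and bounded below;
  for distinct members of \<^const>\<open>L_omega\<close> the set used here always is, while outside
  \<^const>\<open>L_omega\<close> the value of \<open>mu\<close> is of no significance.\<close>

definition mu :: "(int \<Rightarrow> 's) \<Rightarrow> (int \<Rightarrow> 's) \<Rightarrow> real"
  where "mu x y = (if x = y then 0 else 3 powi (- (LEAST m. x m \<noteq> y m)))"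

lemma L_omega_first_difference:
  assumes "x \<in> L_omega S s0" "y \<in> L_omega S s0" "x \<noteq> y"
  obtains m where "x m \<noteq> y m" "\<And>n. n < m \<Longrightarrow> x n = y n" "mu x y = 3 powi (- m)"
proof -
  obtain k l where kl: "\<forall>n<k. x n = s0" "\<forall>n<l. y n = s0"
    using assms by (auto simp: L_omega_def)
  obtain j where j: "x j \<noteq> y j"
    using assms(3) by blast
  have lb: "min k l \<le> n" if "x n \<noteq> y n" for n
    using kl that by (metis min.strict_boundedE not_le)
  define A where "A = {n \<in> {min k l..j}. x n \<noteq> y n}"
  have fin: "finite A"
    by (rule finite_subset[of _ "{min k l..j}"]) (auto simp: A_def)
  have ne: "A \<noteq> {}"
    using j lb[OF j] by (auto simp: A_def)
  define m where "m = Min A"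
  have m: "m \<in> A"
    using fin ne by (simp add: m_def)
  have le: "m \<le> n" if "x n \<noteq> y n" for n
  proof (cases "n \<le> j")
    case True
    with that lb have "n \<in> A" by (simp add: A_def)
    then show ?thesis using fin by (simp add: m_def)
  next
    case False
    with m show ?thesis by (simp add: A_def)
  qed
  have "(LEAST n. x n \<noteq> y n) = m"
    using m le by (intro Least_equality) (auto simp: A_def)
  then show thesis
    using that[of m] m le assms(3) by (force simp: A_def mu_def)
qed

lemma Metric_space_L_omega: "Metric_space (L_omega S s0) mu"
proof
  show "0 \<le> mu x y" for x y :: "int \<Rightarrow> 's"
    by (simp add: mu_def)
  show "mu x y = mu y x" for x y :: "int \<Rightarrow> 's"
    by (simp add: mu_def eq_commute)
  show "mu x y = 0 \<longleftrightarrow> x = y" for x y :: "int \<Rightarrow> 's"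
    by (simp add: mu_def)
next
  fix x y z
  assume L: "x \<in> L_omega S s0" "y \<in> L_omega S s0" "z \<in> L_omega S s0"
  have nn: "0 \<le> mu u v" for u v :: "int \<Rightarrow> 's"
    by (simp add: mu_def)
  show "mu x z \<le> mu x y + mu y z"
  proof (cases "x = y \<or> y = z \<or> x = z")
    case True
    then show ?thesis using nn by (auto simp: mu_def)
  next
    case False
    obtain a where a: "\<And>n. n < a \<Longrightarrow> x n = y n" "mu x y = 3 powi (- a)"
      using L_omega_first_difference[OF L(1,2)] False by blast
    obtain b where b: "\<And>n. n < b \<Longrightarrow> y n = z n" "mu y z = 3 powi (- b)"
      using L_omega_first_difference[OF L(2,3)] False by blast
    obtain c where c: "x c \<noteq> z c" "mu x z = 3 powi (- c)"
      using L_omega_first_difference[OF L(1,3)] False by blast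
    have "a \<le> c \<or> b \<le> c"
      using a(1) b(1) c(1) by (metis not_le)
    then have "mu x z \<le> mu x y \<or> mu x z \<le> mu y z"
      unfolding a(2) b(2) c(2) by (auto intro!: power_int_increasing)
    then show ?thesis
      using nn[of x y] nn[of y z] by linarith
  qed
qed

end

theory Submission
  imports Defs
begin

text \<open>Being joined by a \<open>3\<^sup>-\<^sup>n\<close>-chain is an equivalence relation on \<open>M\<close>, coarser for smaller
  \<open>n\<close>, whose classes are the \<open>3\<^sup>-\<^sup>n\<close>-components. Fix a dense sequence \<open>e\<close>; it meets
  every class at every scale. The embedding sends \<open>x\<close> to the sequence whose \<open>n\<close>-th term encodes the
  least \<open>i\<close> with \<open>e i\<close> in the class of \<open>x\<close> at scale \<open>3\<^sup>-\<^sup>n\<close>. This index is \<open>0\<close> as soon as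
  \<open>d (e 0) x \<le> 3\<^sup>-\<^sup>n\<close>, so the sequence is eventually \<open>s\<^sub>0\<close> to the left. If \<open>m\<close> is the first index
  at which the images of \<open>x\<close> and \<open>y\<close> differ, then \<open>x\<close> and \<open>y\<close> lie in the same component at scale
  \<open>3 \<sqdot> 3\<^sup>-\<^sup>m\<close> but not at scale \<open>3\<^sup>-\<^sup>m\<close>, which bounds \<open>d x y\<close> above and below.\<close>

section \<open>Joinability by chains as an equivalence relation\<close>

definition chain_rel :: "'a set \<Rightarrow> ('a \<Rightarrow> 'a \<Rightarrow> real) \<Rightarrow> real \<Rightarrow> ('a \<times> 'a) set"
  where "chain_rel M d s = {(x, y). x \<in> M \<and> y \<in> M \<and> d x y \<le> s}\<^sup>*"

lemma chain_rel_refl: "(x, x) \<in> chain_rel M d s"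
  by (simp add: chain_rel_def)

lemma chain_rel_step: "x \<in> M \<Longrightarrow> y \<in> M \<Longrightarrow> d x y \<le> s \<Longrightarrow> (x, y) \<in> chain_rel M d s"
  by (auto simp: chain_rel_def)

lemma chain_rel_trans:
  "(x, y) \<in> chain_rel M d s \<Longrightarrow> (y, z) \<in> chain_rel M d s \<Longrightarrow> (x, z) \<in> chain_rel M d s"
  by (auto simp: chain_rel_def)

lemma chain_rel_mono: "s \<le> t \<Longrightarrow> chain_rel M d s \<subseteq> chain_rel M d t"
  unfolding chain_rel_def by (intro rtrancl_mono) auto

text \<open>The reflexive closure also relates a point outside \<open>M\<close> to itself, so one
  end must be assumed in \<open>M\<close>.\<close>

lemma chain_rel_in_carrier: "(x, y) \<in> chain_rel M d s \<Longrightarrow> x \<in> M \<Longrightarrow> y \<in> M"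
  unfolding chain_rel_def by (induction rule: rtrancl_induct) auto

lemma (in Metric_space) chain_rel_sym:
  assumes "(x, y) \<in> chain_rel M d s"
  shows "(y, x) \<in> chain_rel M d s"
proof -
  have "sym {(x, y). x \<in> M \<and> y \<in> M \<and> d x y \<le> s}"
    by (auto simp: sym_def commute)
  then show ?thesis
    using assms unfolding chain_rel_def by (meson sym_rtrancl symD)
qed

section \<open>Classes of the relation as scale components\<close>

lemma scale_chain_Cons_Cons:
  "scale_chain d s (x # y # xs) \<longleftrightarrow> d x y \<le> s \<and> scale_chain d s (y # xs)"
  by (auto simp: scale_chain_def less_Suc_eq_0_disj nth_Cons')

lemma scale_chain_imp_chain_rel:
  assumes "scale_chain d s xs" "xs \<noteq> []" "set xs \<subseteq> M"
  shows "(hd xs, last xs) \<in> chain_rel M d s"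
  using assms
proof (induction xs rule: induct_list012)
  case (3 x y xs)
  then have "(y, last (y # xs)) \<in> chain_rel M d s" "(x, y) \<in> chain_rel M d s"
    by (auto simp: scale_chain_Cons_Cons intro: chain_rel_step)
  then show ?case
    by (auto intro: chain_rel_trans)
qed (auto intro: chain_rel_refl)

text \<open>Connectedness demands chains inside the set itself, so the list has to stay in the class
  of \<open>x\<close>.\<close>

lemma chain_rel_imp_scale_chain:
  assumes "(x, y) \<in> chain_rel M d s"
  shows "\<exists>xs. xs \<noteq> [] \<and> hd xs = x \<and> last xs = y \<and>
    set xs \<subseteq> chain_rel M d s `` {x} \<and> scale_chain d s xs"
  using assms unfolding chain_rel_def
proof (induction rule: converse_rtrancl_induct)
  case base
  show ?case
    by (rule exI[of _ "[y]"]) (auto simp: scale_chain_def)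
next
  case (step x z)
  then obtain xs where xs: "xs \<noteq> []" "hd xs = z" "last xs = y"
      "set xs \<subseteq> chain_rel M d s `` {z}" "scale_chain d s xs"
    unfolding chain_rel_def by blast
  from xs obtain ys where "xs = z # ys"
    by (cases xs) auto
  with xs step(1) show ?case
    unfolding chain_rel_def
    by (intro exI[of _ "x # xs"])
      (auto simp: scale_chain_Cons_Cons intro: converse_rtrancl_into_rtrancl)
qed

lemma (in Metric_space) scale_component_chain_rel:
  assumes "x \<in> M"
  shows "scale_component M d s (chain_rel M d s `` {x})" (is "scale_component M d s ?A")
  unfolding scale_component_def
proof (intro conjI allI impI)
  show "?A \<subseteq> M"
    using assms chain_rel_in_carrier by fastforce
  show "scale_connected d s ?A"
    unfolding scale_connected_def
  proof (intro ballI)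
    fix y z
    assume "y \<in> ?A" "z \<in> ?A"
    then have "(y, z) \<in> chain_rel M d s" and sub: "chain_rel M d s `` {y} \<subseteq> ?A"
      by (auto intro: chain_rel_sym chain_rel_trans)
    then obtain xs where xs: "xs \<noteq> [] \<and> hd xs = y \<and> last xs = z \<and>
        set xs \<subseteq> chain_rel M d s `` {y} \<and> scale_chain d s xs"
      using chain_rel_imp_scale_chain by meson
    with sub have "set xs \<subseteq> ?A"
      by (meson subset_trans)
    with xs show "\<exists>xs. xs \<noteq> [] \<and> hd xs = y \<and> last xs = z \<and> set xs \<subseteq> ?A \<and> scale_chain d s xs"
      by (intro exI[of _ xs]) blast
  qed
next
  fix B
  assume B: "?A \<subseteq> B \<and> B \<subseteq> M \<and> scale_connected d s B"
  have "x \<in> B"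
    using B chain_rel_refl by fastforce
  \<comment> \<open>Maximality: a chain from \<open>x\<close> inside \<open>B\<close> is a chain
    inside \<open>M\<close>, so its end lies in the class of \<open>x\<close>.\<close>
  have "B \<subseteq> ?A"
  proof
    fix y
    assume "y \<in> B"
    then obtain xs where "xs \<noteq> []" "hd xs = x" "last xs = y" "set xs \<subseteq> B" "scale_chain d s xs"
      using B \<open>x \<in> B\<close> unfolding scale_connected_def by blast
    then show "y \<in> ?A"
      using scale_chain_imp_chain_rel[of d s xs M] B by auto
  qed
  then show "B = ?A"
    using B by blast
qed

lemma (in Metric_space) dim_AN_le_0_chain_rel_bound:
  assumes "dim_AN_le_0 M d"
  obtains K where "K \<ge> 1"
    "\<And>s x y. s > 0 \<Longrightarrow> x \<in> M \<Longrightarrow> (x, y) \<in> chain_rel M d s \<Longrightarrow> d x y \<le> K * s"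
proof -
  obtain K where K: "K \<ge> 1" "\<forall>s>0. \<forall>A. scale_component M d s A \<longrightarrow> dist_bounded d (K * s) A"
    using assms unfolding dim_AN_le_0_def by blast
  have "d x y \<le> K * s" if "s > 0" "x \<in> M" "(x, y) \<in> chain_rel M d s" for s x y
  proof -
    have "dist_bounded d (K * s) (chain_rel M d s `` {x})"
      using K(2) scale_component_chain_rel that by blast
    then show ?thesis
      using that chain_rel_refl[of x M d s] unfolding dist_bounded_def by blast
  qed
  with K(1) that show thesis
    by blast
qed

section \<open>Enumerations and powers\<close>

lemma (in Metric_space) dense_sequence:
  assumes "separable_space mtopology" "M \<noteq> {}"
  obtains e :: "nat \<Rightarrow> 'a" where "range e \<subseteq> M" "\<And>x r. x \<in> M \<Longrightarrow> r > 0 \<Longrightarrow> \<exists>i. d (e i) x < r"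
proof -
  obtain C where C: "countable C" "C \<subseteq> M" "mtopology closure_of C = M"
    using assms(1) unfolding separable_space_def by auto
  \<comment> \<open>Nonemptiness makes \<open>from_nat_into C\<close> onto \<open>C\<close>, with
    repetitions if \<open>C\<close> is finite.\<close>
  have "C \<noteq> {}"
    using C(3) assms(2) by auto
  then have rng: "range (from_nat_into C) = C"
    using C(1) by (rule range_from_nat_into)
  show thesis
  proof
    show "range (from_nat_into C) \<subseteq> M"
      using rng C(2) by simp
    fix x and r :: real
    assume "x \<in> M" "r > 0"
    then obtain c where "c \<in> C" "c \<in> mball x r"
      using C(3) unfolding metric_closure_of by blast
    then show "\<exists>i. d (from_nat_into C i) x < r"
      by (metis rng imageE in_mball commute)
  qed
qed

lemma countable_infinite_enumeration_from:
  assumes "countable S" "infinite S" "s0 \<in> S"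
  obtains g :: "nat \<Rightarrow> 'a" where "inj g" "range g \<subseteq> S" "g 0 = s0"
proof -
  have bij: "bij_betw (from_nat_into S) UNIV S"
    using assms bij_betw_from_nat_into by blast
  then obtain j where j: "from_nat_into S j = s0"
    using assms(3) by (metis bij_betw_imp_surj_on imageE)
  \<comment> \<open>The swap gives \<open>s0\<close> the index 0, which is the index taken at all
    coarse scales.\<close>
  define g where "g = from_nat_into S \<circ> Transposition.transpose 0 j"
  have "bij_betw g UNIV S"
    unfolding g_def by (rule bij_betw_trans[OF _ bij]) simp
  then have "inj g" "range g \<subseteq> S"
    by (auto simp: bij_betw_def)
  then show thesis
    using that[of g] j by (simp add: g_def)
qed

text \<open>Coarse scales exceed any distance, for the constant left tails; fine scales drop below
  any positive one, for injectivity.\<close>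

lemma powi_minus_archimedean:
  fixes b c :: real
  assumes "b > 1"
  shows "\<exists>k. \<forall>n<k. c \<le> b powi (- n)" and "c > 0 \<Longrightarrow> \<exists>n::int. b powi (- n) < c"
proof -
  obtain N where N: "c < b ^ N"
    using real_arch_pow[OF assms] by blast
  have "c \<le> b powi (- n)" if "n < - int N" for n
  proof -
    have "c \<le> b powi (int N)"
      using N by simp
    also have "\<dots> \<le> b powi (- n)"
      using that assms by (intro power_int_increasing) auto
    finally show ?thesis .
  qed
  then show "\<exists>k. \<forall>n<k. c \<le> b powi (- n)"
    by blast
  assume "c > 0"
  obtain N' where "inverse c < b ^ N'"
    using real_arch_pow[OF assms] by blast
  then have "b powi (- int N') < c"
    using \<open>c > 0\<close> assms by (simp add: power_int_minus field_simps)
  then show "\<exists>n::int. b powi (- n) < c"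
    by blast
qed

section \<open>The embedding and its distortion\<close>

theorem theorem3p4:
  fixes M :: "'a set" and d :: "'a \<Rightarrow> 'a \<Rightarrow> real"
    and S :: "'s set" and s0 :: 's
  assumes "countable S" and "infinite S" and "s0 \<in> S"
    and "Metric_space M d"
    and "separable_space (Metric_space.mtopology M d)"
    and "dim_AN_le_0 M d"
  shows "\<exists>f. bilipschitz_embedding M d (L_omega S s0) mu f"
proof (cases "M = {}")
  case True
  then show ?thesis
    by (auto simp: bilipschitz_embedding_def Lipschitz_with_def intro: exI[of _ 1])
next
  case False
  interpret Metric_space M d by fact
  obtain K where K: "K \<ge> 1"
    "\<And>s x y. s > 0 \<Longrightarrow> x \<in> M \<Longrightarrow> (x, y) \<in> chain_rel M d s \<Longrightarrow> d x y \<le> K * s"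
    using dim_AN_le_0_chain_rel_bound assms(6) by blast
  obtain e :: "nat \<Rightarrow> 'a" where e: "range e \<subseteq> M" "\<And>x r. x \<in> M \<Longrightarrow> r > 0 \<Longrightarrow> \<exists>i. d (e i) x < r"
    using dense_sequence[OF assms(5) False] by blast
  obtain g :: "nat \<Rightarrow> 's" where g: "inj g" "range g \<subseteq> S" "g 0 = s0"
    by (rule countable_infinite_enumeration_from[OF assms(1-3)])
  define R where "R n = chain_rel M d (3 powi (- n))" for n :: int
  define idx where "idx x n = (LEAST i. (e i, x) \<in> R n)" for x n
  define f where "f x = (\<lambda>n. g (idx x n))" for x
  have eM: "e i \<in> M" for i
    using e(1) by blast
  \<comment> \<open>Density puts some \<open>e i\<close> within one step of \<open>x\<close>, so the
    least index is attained.\<close>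
  have idx_R: "(e (idx x n), x) \<in> R n" if x: "x \<in> M" for x n
  proof -
    obtain i where "d (e i) x < 3 powi (- n)"
      using e(2)[OF x] by (metis zero_less_power_int zero_less_numeral)
    then have "(e i, x) \<in> R n"
      unfolding R_def using x eM by (intro chain_rel_step) auto
    then show ?thesis
      unfolding idx_def by (rule LeastI)
  qed
  \<comment> \<open>Equal symbols mean a common point \<open>e i\<close> in both classes;
    conversely, equal classes contain the same \<open>e i\<close>.\<close>
  have f_eq_iff: "f x n = f y n \<longleftrightarrow> (x, y) \<in> R n" if xy: "x \<in> M" "y \<in> M" for x y n
  proof
    assume "f x n = f y n"
    then have "idx x n = idx y n"
      using g(1) by (simp add: f_def inj_eq)
    then show "(x, y) \<in> R n"
      using idx_R xy unfolding R_def by (metis chain_rel_sym chain_rel_trans)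
  next
    assume "(x, y) \<in> R n"
    then have "(e i, x) \<in> R n \<longleftrightarrow> (e i, y) \<in> R n" for i
      unfolding R_def by (metis chain_rel_sym chain_rel_trans)
    then show "f x n = f y n"
      by (simp add: f_def idx_def)
  qed
  have f_L: "f x \<in> L_omega S s0" if x: "x \<in> M" for x
  proof -
    obtain k where k: "\<forall>n<k. d (e 0) x \<le> 3 powi (- n)"
      using powi_minus_archimedean(1)[of 3 "d (e 0) x"] by auto
    have "f x n = s0" if "n < k" for n
    proof -
      have "(e 0, x) \<in> R n"
        unfolding R_def using x eM k that by (intro chain_rel_step) auto
      then have "idx x n = 0"
        unfolding idx_def by (intro Least_eq_0)
      then show ?thesis
        by (simp add: f_def g(3))
    qed
    then show ?thesis
      using g(2) by (auto simp: L_omega_def f_def)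
  qed
  \<comment> \<open>Equal images would join \<open>x\<close> and \<open>y\<close> at every scale,
    forcing \<open>d x y \<le> K * 3 powi (- n)\<close> for all \<open>n\<close>.\<close>
  have f_ne: "f x \<noteq> f y" if xy: "x \<in> M" "y \<in> M" "x \<noteq> y" for x y
  proof
    assume "f x = f y"
    then have R: "(x, y) \<in> R n" for n
      using f_eq_iff xy by metis
    have "d x y / K > 0"
      using xy K(1) mdist_pos_eq by auto
    then obtain n :: int where "3 powi (- n) < d x y / K"
      using powi_minus_archimedean(2)[of 3 "d x y / K"] by auto
    moreover have "d x y \<le> K * 3 powi (- n)"
      using K(2) R xy(1) unfolding R_def by simp
    ultimately show False
      using K(1) by (simp add: field_simps)
  qed
  have bounds: "mu (f x) (f y) \<le> d x y" "d x y \<le> 3 * K * mu (f x) (f y)"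
    if xy: "x \<in> M" "y \<in> M" for x y
  proof -
    have "mu (f x) (f y) \<le> d x y \<and> d x y \<le> 3 * K * mu (f x) (f y)"
    proof (cases "x = y")
      case True
      then show ?thesis
        using xy by (simp add: mu_def)
    next
      case False
      then obtain m where m: "f x m \<noteq> f y m" "\<And>n. n < m \<Longrightarrow> f x n = f y n"
          "mu (f x) (f y) = 3 powi (- m)"
        using L_omega_first_difference[OF f_L[OF xy(1)] f_L[OF xy(2)]] f_ne xy by metis
      have "(x, y) \<notin> R m" "(x, y) \<in> R (m - 1)"
        using m f_eq_iff xy by auto
      \<comment> \<open>A single step is already a chain, so separation at \<open>m\<close> bounds
        \<open>d x y\<close> below; passing to \<open>m - 1\<close> costs the factor 3 in the upper
        bound.\<close>
      then have "3 powi (- m) < d x y" "d x y \<le> K * 3 powi (- (m - 1))"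
        using chain_rel_step[OF xy, of d "3 powi (- m)"] K(2)[OF _ xy(1), of "3 powi (- (m - 1))" y]
        unfolding R_def by (meson not_le, simp)
      moreover have "(3 :: real) powi (- (m - 1)) = 3 * 3 powi (- m)"
        using power_int_add_1'[of "3 :: real" "- m"] by simp
      ultimately show ?thesis
        using m(3) by simp
    qed
    then show "mu (f x) (f y) \<le> d x y" "d x y \<le> 3 * K * mu (f x) (f y)"
      by auto
  qed
  have inj: "inj_on f M"
    using f_ne by (meson inj_onI)
  \<comment> \<open>One constant must serve both directions, so the bound with constant 1 is
    weakened using \<open>K \<ge> 1\<close>.\<close>
  have "Lipschitz_with (3 * K) M d mu f"
    unfolding Lipschitz_with_def
  proof (intro ballI)
    fix x y
    assume "x \<in> M" "y \<in> M"
    moreover have "1 * d x y \<le> 3 * K * d x y"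
      using K(1) by (intro mult_right_mono) auto
    ultimately show "mu (f x) (f y) \<le> 3 * K * d x y"
      using bounds(1)[of x y] by linarith
  qed
  moreover have "Lipschitz_with (3 * K) (f ` M) mu d (inv_into M f)"
    unfolding Lipschitz_with_def using bounds(2) inj by simp
  moreover have "3 * K > 0"
    using K(1) by simp
  ultimately show ?thesis
    unfolding bilipschitz_embedding_def using f_L inj by blast
qed

end
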